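(* Fix $a\in\mathbb{Z}$, let $\delta=a^2-4$, and define $(u_n)_{n\geq 0}$ and $(v_n)_{n\geq 0}$ by $u_0=0$, $u_1=1$, $u_{n+2}=au_{n+1}-u_n$ and $v_0=2$, $v_1=a$, $v_{n+2}=av_{n+1}-v_n$. Let $n\in\mathbb{Z}_{>0}$ with $u_n\neq 0$, and let $k\in\mathbb{Z}_{>0}$ be odd. Then $u_n\mid u_{nk}$ and $$\frac{u_{nk}}{u_n}\equiv k+\frac{\delta k(k^2-1)}{24}u_n^2\pmod{u_n^4}.$$ Moreover, there are $\Psi_k,\Psi_k^*\in\mathbb{Z}[W]$ such that $$v_{nk}=v_n\Psi_k(\delta u_n^2)\quad\text{and}\quad\Psi_k(W)=1+\frac{k^2-1}{8}W+W^2\Psi_k^*(W).$$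
   Context: For odd $k$, $k(k^2-1)/24$ and $(k^2-1)/8$ are integers, so the congruence is between integers. *)

theory Defs
  imports
    "HOL-Computational_Algebra.Polynomial"
    "HOL-Number_Theory.Cong"
begin

fun lucas_u :: "int \<Rightarrow> nat \<Rightarrow> int" where
  "lucas_u a 0 = 0"
| "lucas_u a (Suc 0) = 1"
| "lucas_u a (Suc (Suc n)) = a * lucas_u a (Suc n) - lucas_u a n"

fun lucas_v :: "int \<Rightarrow> nat \<Rightarrow> int" where
  "lucas_v a 0 = 2"
| "lucas_v a (Suc 0) = a"
| "lucas_v a (Suc (Suc n)) = a * lucas_v a (Suc n) - lucas_v a n"

definition lucas_delta :: "int \<Rightarrow> int" where
  "lucas_delta a = a\<^sup>2 - 4"

text \<open>The next two lemmas show that, for odd \<open>k\<close>, the integer divisions by 8 and 24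
  in the expansions of \<open>u\<^bsub>nk\<^esub> / u\<^sub>n\<close> and \<open>\<Psi>\<^sub>k\<close> are exact.\<close>

lemma eight_dvd_odd_square_minus_one:
  fixes k :: int
  assumes "odd k"
  shows "8 dvd k\<^sup>2 - 1"
proof -
  obtain m where k: "k = 2 * m + 1" using assms by (elim oddE)
  have "even (m * (m + 1))" by simp
  then obtain r where "m * (m + 1) = 2 * r" by (elim evenE)
  then have "k\<^sup>2 - 1 = 8 * r" unfolding k by (simp add: power2_eq_square algebra_simps)
  then show ?thesis by simp
qed

lemma twentyfour_dvd_odd_times_square_minus_one:
  fixes k :: int
  assumes "odd k"
  shows "24 dvd k * (k\<^sup>2 - 1)"
proof -
  have "3 dvd k * (k\<^sup>2 - 1)"
  proof -
    have f: "k * (k\<^sup>2 - 1) = (k - 1) * k * (k + 1)"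
      by (simp add: power2_eq_square algebra_simps)
    have "3 dvd k - 1 \<or> 3 dvd k \<or> 3 dvd k + 1" by presburger
    then show ?thesis unfolding f by auto
  qed
  moreover have "8 dvd k * (k\<^sup>2 - 1)"
    using eight_dvd_odd_square_minus_one[OF assms] by simp
  ultimately show ?thesis by presburger
qed

end

(* Put W = \<delta> u_n^2 = v_n^2 - 4. Every solution x of x_{i+2} = a x_{i+1} - x_i satisfies
   x_{s+2n} = v_n x_{s+n} - x_s, so along the odd multiples of n it is a recurrence
   X_{j+2} = v_{2n} X_{j+1} - X_j with v_{2n} = W + 2. Hence x_{n(2j+1)} = x_n P_j(W), where P_j is an
   integer polynomial with P_0 = 1 and P_1 = W + 3 for x = u, P_1 = W + 1 for x = v. The constant
   and linear coefficients of P_j satisfy linear recurrences in j that are solved explicitly. *)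

theory Submission imports Defs begin

lemma lucas_recurrence_add_double:
  fixes x :: "nat \<Rightarrow> int"
  assumes rec: "\<And>i. x (Suc (Suc i)) = a * x (Suc i) - x i"
  shows "x (s + 2 * n) = lucas_v a n * x (s + n) - x s"
proof (induction n arbitrary: s rule: induct_nat_012)
  case 0
  then show ?case by simp
next
  case 1
  then show ?case by (simp add: rec)
next
  case (ge2 n)
  \<comment> \<open>Shifting \<open>s\<close> by 1 and by 2 gives both induction hypotheses the same
    middle term \<open>x (Suc (Suc (s + n)))\<close>, so their \<open>lucas_v\<close> coefficients
    combine by the recurrence.\<close>
  have 1: "x (Suc (s + 2 * Suc n)) = lucas_v a (Suc n) * x (Suc (Suc (s + n))) - x (Suc s)"
    using ge2(2)[of "Suc s"] by simp
  have 2: "x (s + 2 * Suc n) = lucas_v a n * x (Suc (Suc (s + n))) - x (Suc (Suc s))"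
    using ge2(1)[of "Suc (Suc s)"] by simp
  have "x (s + 2 * Suc (Suc n)) = a * x (Suc (s + 2 * Suc n)) - x (s + 2 * Suc n)"
    using rec[of "s + 2 * Suc n"] by simp
  then show ?case
    unfolding 1 2 by (simp add: rec[of s] algebra_simps)
qed

text \<open>The form Y^2 - a X Y + X^2 is invariant under the recurrence step (X, Y) -> (Y, a Y - X)
  and equals 1 at (0, 1).\<close>

lemma lucas_u_consecutive:
  "(lucas_u a (Suc n))\<^sup>2 - a * lucas_u a n * lucas_u a (Suc n) + (lucas_u a n)\<^sup>2 = 1"
  by (induction n) (simp_all add: power2_eq_square algebra_simps)

lemma lucas_v_eq_lucas_u: "lucas_v a n = 2 * lucas_u a (Suc n) - a * lucas_u a n"
proof (induction a n rule: lucas_v.induct)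
  case (3 a n)
  show ?case unfolding lucas_v.simps 3 by (simp add: algebra_simps)
qed simp_all

text \<open>Completing the square: four times the invariant form is (2 Y - a X)^2 - (a^2 - 4) X^2,
  and 2 Y - a X is v_n.\<close>

lemma lucas_v_square: "(lucas_v a n)\<^sup>2 = lucas_delta a * (lucas_u a n)\<^sup>2 + 4"
proof -
  have "(lucas_v a n)\<^sup>2 = lucas_delta a * (lucas_u a n)\<^sup>2
      + 4 * ((lucas_u a (Suc n))\<^sup>2 - a * lucas_u a n * lucas_u a (Suc n) + (lucas_u a n)\<^sup>2)"
    unfolding lucas_v_eq_lucas_u lucas_delta_def by (simp add: power2_eq_square algebra_simps)
  then show ?thesis
    by (simp add: lucas_u_consecutive)
qed

text \<open>The parameter \<open>c\<close> treats both sequences at once: \<open>c = 3\<close>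
  serves u and \<open>c = 1\<close> serves v. These are the Chebyshev polynomials of the fourth and
  third kind at W/2 + 1.\<close>

fun odd_multiple_poly :: "int \<Rightarrow> nat \<Rightarrow> int poly" where
  "odd_multiple_poly c 0 = 1"
| "odd_multiple_poly c (Suc 0) = [:c, 1:]"
| "odd_multiple_poly c (Suc (Suc j)) =
     [:2, 1:] * odd_multiple_poly c (Suc j) - odd_multiple_poly c j"

lemma coeff_0_odd_multiple_poly: "coeff (odd_multiple_poly c j) 0 = 1 + (c - 1) * int j"
  by (induction c j rule: odd_multiple_poly.induct) (simp_all add: algebra_simps)

text \<open>The second difference in \<open>j\<close> of the linear coefficients is the constant
  coefficient at \<open>Suc j\<close>, which is affine in \<open>j\<close>; hence a polynomial of
  degree at most 3, with denominators cleared by 6.\<close>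

lemma coeff_1_odd_multiple_poly:
  "6 * coeff (odd_multiple_poly c j) 1 = int j * (int j + 1) * (3 + (c - 1) * (int j - 1))"
proof (induction c j rule: odd_multiple_poly.induct)
  case (3 c j)
  have "coeff (odd_multiple_poly c (Suc (Suc j))) 1 =
      2 * coeff (odd_multiple_poly c (Suc j)) 1 + (1 + (c - 1) * int (Suc j))
      - coeff (odd_multiple_poly c j) 1"
    by (simp add: coeff_0_odd_multiple_poly)
  then have "6 * coeff (odd_multiple_poly c (Suc (Suc j))) 1 =
      2 * (6 * coeff (odd_multiple_poly c (Suc j)) 1) + 6 * (1 + (c - 1) * int (Suc j))
      - 6 * coeff (odd_multiple_poly c j) 1"
    by simp
  also have "\<dots> = int (Suc (Suc j)) * (int (Suc (Suc j)) + 1) * (3 + (c - 1) * (int (Suc (Suc j)) - 1))"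
    unfolding 3 by (simp add: algebra_simps)
  finally show ?case .
qed simp_all

lemma poly_split_linear_part:
  fixes p :: "'a::comm_semiring_1 poly"
  obtains q where "p = [:coeff p 0, coeff p 1:] + monom 1 2 * q"
proof -
  obtain c0 c1 q where "p = pCons c0 (pCons c1 q)"
    by (metis pCons_cases)
  then have "p = [:coeff p 0, coeff p 1:] + monom 1 2 * q"
    by (simp add: numeral_2_eq_2 monom_Suc)
  then show ?thesis by (rule that)
qed

text \<open>Since x_{3n} = (W + 3) x_n - v_n x_0, the hypothesis \<open>init\<close> makes x_{3n} =
  (W + c) x_n. It reads 0 = 0 for u with \<open>c = 3\<close>, and 2 v_n = 2 v_n for v with
  \<open>c = 1\<close>.\<close>

lemma lucas_recurrence_odd_multiple:
  fixes x :: "nat \<Rightarrow> int"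
  assumes rec: "\<And>i. x (Suc (Suc i)) = a * x (Suc i) - x i"
    and init: "lucas_v a n * x 0 = (3 - c) * x n"
  shows "x (n * (2 * j + 1)) = x n * poly (odd_multiple_poly c j) (lucas_delta a * (lucas_u a n)\<^sup>2)"
proof -
  define W where "W = lucas_delta a * (lucas_u a n)\<^sup>2"
  note double = lucas_recurrence_add_double[where x = x, OF rec]
  have vv: "lucas_v a n * lucas_v a n = W + 4"
    using lucas_v_square[of a n] by (simp add: W_def power2_eq_square)
  have v2: "lucas_v a (2 * n) = W + 2"
    using lucas_recurrence_add_double[of "lucas_v a" a 0 n] vv by simp
  have x3: "x (n * 3) = x n * (W + c)"
  proof -
    have "x (n * 3) = lucas_v a n * x (2 * n) - x n"
      using double[of n n] by (simp add: mult_2 mult.commute[of n] numeral_3_eq_3 add.assoc)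
    also have "x (2 * n) = lucas_v a n * x n - x 0"
      using double[of 0 n] by simp
    also have "lucas_v a n * (lucas_v a n * x n - x 0) - x n =
        (lucas_v a n * lucas_v a n) * x n - lucas_v a n * x 0 - x n"
      by (simp add: algebra_simps)
    finally show ?thesis
      unfolding vv init by (simp add: algebra_simps)
  qed
  have "x (n * (2 * j + 1)) = x n * poly (odd_multiple_poly c j) W"
  proof (induction j rule: induct_nat_012)
    case 0
    then show ?case by simp
  next
    case 1
    then show ?case using x3 by (simp add: add.commute numeral_3_eq_3)
  next
    case (ge2 j)
    \<comment> \<open>The doubling rule is used with \<open>2 * n\<close> in place of
      \<open>n\<close>, so it moves between consecutive odd multiples.\<close>
    have "x (n * (2 * Suc (Suc j) + 1)) = x (n * (2 * j + 1) + 2 * (2 * n))"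
      by (rule arg_cong[of _ _ x]) (simp add: algebra_simps)
    also have "\<dots> = (W + 2) * x (n * (2 * j + 1) + 2 * n) - x (n * (2 * j + 1))"
      using double[of "n * (2 * j + 1)" "2 * n"] v2 by simp
    also have "n * (2 * j + 1) + 2 * n = n * (2 * Suc j + 1)"
      by (simp add: algebra_simps)
    finally show ?case
      unfolding ge2 by (simp add: algebra_simps)
  qed
  then show ?thesis unfolding W_def .
qed

theorem corollary5p2:
  fixes k :: nat
  assumes "0 < k" and "odd k"
  shows "(\<forall>(a::int) (n::nat). 0 < n \<longrightarrow> lucas_u a n \<noteq> 0 \<longrightarrow>
            lucas_u a n dvd lucas_u a (n * k) \<and>
            [lucas_u a (n * k) div lucas_u a n =
               int k + lucas_delta a * (int k * ((int k)\<^sup>2 - 1) div 24) * (lucas_u a n)\<^sup>2]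
              (mod (lucas_u a n) ^ 4))
       \<and> (\<exists>(\<Psi>::int poly) (\<Psi>'::int poly).
            \<Psi> = [:1, ((int k)\<^sup>2 - 1) div 8:] + monom 1 2 * \<Psi>' \<and>
            (\<forall>(a::int) (n::nat). 0 < n \<longrightarrow> lucas_u a n \<noteq> 0 \<longrightarrow>
               lucas_v a (n * k) = lucas_v a n * poly \<Psi> (lucas_delta a * (lucas_u a n)\<^sup>2)))"
proof -
  obtain j where k: "k = 2 * j + 1"
    using assms(2) by (elim oddE)
  define \<Phi> where "\<Phi> = odd_multiple_poly 3 j"
  define \<Psi> where "\<Psi> = odd_multiple_poly 1 j"
  obtain \<Phi>' where \<Phi>': "\<Phi> = [:coeff \<Phi> 0, coeff \<Phi> 1:] + monom 1 2 * \<Phi>'"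
    by (rule poly_split_linear_part)
  obtain \<Psi>' where \<Psi>': "\<Psi> = [:coeff \<Psi> 0, coeff \<Psi> 1:] + monom 1 2 * \<Psi>'"
    by (rule poly_split_linear_part)
  have \<Phi>0: "coeff \<Phi> 0 = int k"
    by (simp add: \<Phi>_def coeff_0_odd_multiple_poly k)
  \<comment> \<open>Here the coefficient is j (j + 1) (2 j + 1) / 6, and k^2 - 1 = 4 j (j + 1) turns
    6 into 24.\<close>
  have "int k * ((int k)\<^sup>2 - 1) = 24 * coeff \<Phi> 1"
    using coeff_1_odd_multiple_poly[of 3 j]
    by (simp add: \<Phi>_def k power2_eq_square algebra_simps)
  then have \<Phi>1: "coeff \<Phi> 1 = int k * ((int k)\<^sup>2 - 1) div 24"
    by simp
  have \<Psi>0: "coeff \<Psi> 0 = 1"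
    by (simp add: \<Psi>_def coeff_0_odd_multiple_poly)
  \<comment> \<open>For \<open>c = 1\<close> the coefficient is j (j + 1) / 2.\<close>
  have "(int k)\<^sup>2 - 1 = 8 * coeff \<Psi> 1"
    using coeff_1_odd_multiple_poly[of 1 j]
    by (simp add: \<Psi>_def k power2_eq_square algebra_simps)
  then have \<Psi>1: "coeff \<Psi> 1 = ((int k)\<^sup>2 - 1) div 8"
    by simp
  have u: "lucas_u a (n * k) = lucas_u a n * poly \<Phi> (lucas_delta a * (lucas_u a n)\<^sup>2)" for a n
    unfolding k \<Phi>_def by (rule lucas_recurrence_odd_multiple) simp_all
  have v: "lucas_v a (n * k) = lucas_v a n * poly \<Psi> (lucas_delta a * (lucas_u a n)\<^sup>2)" for a n
    unfolding k \<Psi>_def by (rule lucas_recurrence_odd_multiple) simp_all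
  have "[lucas_u a (n * k) div lucas_u a n =
           int k + lucas_delta a * (int k * ((int k)\<^sup>2 - 1) div 24) * (lucas_u a n)\<^sup>2]
          (mod (lucas_u a n) ^ 4)" if "lucas_u a n \<noteq> 0" for a n
  proof -
    define W where "W = lucas_delta a * (lucas_u a n)\<^sup>2"
    have "poly \<Phi> W = coeff \<Phi> 0 + W * coeff \<Phi> 1 + W\<^sup>2 * poly \<Phi>' W"
      by (subst \<Phi>') (simp add: poly_monom)
    then have "lucas_u a (n * k) div lucas_u a n
        - (int k + lucas_delta a * coeff \<Phi> 1 * (lucas_u a n)\<^sup>2) = W\<^sup>2 * poly \<Phi>' W"
      using that by (simp add: u W_def \<Phi>0)
    \<comment> \<open>The modulus u_n^4 appears because W is a multiple of u_n^2 and the remainder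
      starts at W^2.\<close>
    also have "\<dots> = (lucas_u a n) ^ 4 * ((lucas_delta a)\<^sup>2 * poly \<Phi>' W)"
      by (simp add: W_def power_mult_distrib)
    finally show ?thesis
      unfolding cong_iff_dvd_diff \<Phi>1 by simp
  qed
  moreover have "lucas_u a n dvd lucas_u a (n * k)" for a n
    by (simp add: u)
  moreover have "\<Psi> = [:1, ((int k)\<^sup>2 - 1) div 8:] + monom 1 2 * \<Psi>'"
    using \<Psi>' unfolding \<Psi>0 \<Psi>1 .
  ultimately show ?thesis
    using v by blast
qed

end
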